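(* Let $d\ge2$ be an integer. Then there is a sequence $\Phi=\{\varphi_1,\varphi_2,\dots\}$ of multipliers of the Drury-Arveson space $H^2_d$ such that the row operator $\Phi^R:(h_1,h_2,\dots)^T\mapsto\sum_j\varphi_jh_j$ is bounded $\bigoplus_{j=1}^\infty H^2_d\to H^2_d$, but the column operator $\Phi^C:h\mapsto(\varphi_1h,\varphi_2h,\dots)^T$ is unbounded $H^2_d\to\bigoplus_{j=1}^\infty H^2_d$ (i.e. $\Phi^C$ does not define a bounded operator between these spaces).
   Context: The Drury-Arveson space $H^2_d$ is the Hilbert space of analytic functions on the open unit ball $\mathbb{B}_d$ of $\mathbb{C}^d$ with reproducing kernel $k_w(z)=\frac{1}{1-\langle z,w\rangle}$, $\langle z,w\rangle=\sum_{i=1}^dz_i\overline{w_i}$. A multiplier of $H^2_d$ is a function $\varphi$ on $\mathbb{B}_d$ with $\varphi H^2_d\subseteq H^2_d$. *)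

theory Defs
  imports "HOL-Analysis.Analysis"
begin

text \<open>
  A complex Hilbert space of functions on a set \<open>X\<close> is given by a carrier \<open>H\<close> and an inner
  product \<open>ip\<close>, linear in the first argument. A function on \<open>X\<close> is represented by
  its extension by \<open>0\<close> to the ambient type. Only the values of \<open>ip\<close> on \<open>H\<close> matter.
\<close>

definition hnorm :: "(('a \<Rightarrow> complex) \<Rightarrow> ('a \<Rightarrow> complex) \<Rightarrow> complex) \<Rightarrow> ('a \<Rightarrow> complex) \<Rightarrow> real"
  where "hnorm ip f = sqrt (Re (ip f f))"

locale hilbert_function_space =
  fixes X :: "'a set"
    and H :: "('a \<Rightarrow> complex) set"
    and ip :: "('a \<Rightarrow> complex) \<Rightarrow> ('a \<Rightarrow> complex) \<Rightarrow> complex"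
  assumes zero_outside: "\<lbrakk>f \<in> H; z \<notin> X\<rbrakk> \<Longrightarrow> f z = 0"
    and zero_mem: "(\<lambda>z. 0) \<in> H"
    and add_mem: "\<lbrakk>f \<in> H; g \<in> H\<rbrakk> \<Longrightarrow> (\<lambda>z. f z + g z) \<in> H"
    and scale_mem: "f \<in> H \<Longrightarrow> (\<lambda>z. c * f z) \<in> H"
    and ip_add: "\<lbrakk>f \<in> H; g \<in> H; h \<in> H\<rbrakk> \<Longrightarrow> ip (\<lambda>z. f z + g z) h = ip f h + ip g h"
    and ip_scale: "\<lbrakk>f \<in> H; h \<in> H\<rbrakk> \<Longrightarrow> ip (\<lambda>z. c * f z) h = c * ip f h"
    and ip_commute: "\<lbrakk>f \<in> H; g \<in> H\<rbrakk> \<Longrightarrow> ip g f = cnj (ip f g)"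
    and ip_nonneg: "f \<in> H \<Longrightarrow> 0 \<le> Re (ip f f)"
    and ip_definite: "\<lbrakk>f \<in> H; ip f f = 0\<rbrakk> \<Longrightarrow> f = (\<lambda>z. 0)"
    and complete:
      "\<lbrakk>\<And>n. F n \<in> H;
        \<And>e. 0 < e \<Longrightarrow> \<exists>N. \<forall>m\<ge>N. \<forall>n\<ge>N. hnorm ip (\<lambda>z. F m z - F n z) < e\<rbrakk>
       \<Longrightarrow> \<exists>g\<in>H. (\<lambda>n. hnorm ip (\<lambda>z. F n z - g z)) \<longlonglongrightarrow> 0"

definition has_reproducing_kernel ::
    "'a set \<Rightarrow> ('a \<Rightarrow> complex) set \<Rightarrow> (('a \<Rightarrow> complex) \<Rightarrow> ('a \<Rightarrow> complex) \<Rightarrow> complex)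
     \<Rightarrow> ('a \<Rightarrow> 'a \<Rightarrow> complex) \<Rightarrow> bool"
  where "has_reproducing_kernel X H ip k \<longleftrightarrow>
    (\<forall>w\<in>X. k w \<in> H \<and> (\<forall>f\<in>H. f w = ip f (k w)))"

definition cinner :: "complex ^ 'n \<Rightarrow> complex ^ 'n \<Rightarrow> complex"
  where "cinner z w = (\<Sum>i\<in>UNIV. z $ i * cnj (w $ i))"

text \<open>Analyticity in several variables: real differentiability with complex-linear derivative.\<close>

definition analytic_several :: "(complex ^ 'n \<Rightarrow> complex) \<Rightarrow> (complex ^ 'n) set \<Rightarrow> bool"
  where "analytic_several f U \<longleftrightarrow>
    (\<forall>z\<in>U. \<exists>D. (f has_derivative D) (at z) \<and> (\<forall>c v. D (c *s v) = c * D v))"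

definition da_kernel :: "complex ^ 'n \<Rightarrow> complex ^ 'n \<Rightarrow> complex"
  where "da_kernel w z = (if z \<in> ball 0 1 then 1 / (1 - cinner z w) else 0)"

text \<open>A reproducing kernel determines its Hilbert space, so this fixes \<open>H\<close>, and \<open>ip\<close> on \<open>H\<close>.\<close>

definition drury_arveson ::
    "(complex ^ 'n \<Rightarrow> complex) set
     \<Rightarrow> ((complex ^ 'n \<Rightarrow> complex) \<Rightarrow> (complex ^ 'n \<Rightarrow> complex) \<Rightarrow> complex) \<Rightarrow> bool"
  where "drury_arveson H ip \<longleftrightarrow>
    hilbert_function_space (ball 0 1) H ip \<and>
    (\<forall>f\<in>H. analytic_several f (ball 0 1)) \<and>
    has_reproducing_kernel (ball 0 1) H ip da_kernel"

text \<open>Values of \<open>\<phi>\<close> off the underlying set are irrelevant, as the elements of \<open>H\<close> vanish there.\<close>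

definition multiplier :: "('a \<Rightarrow> complex) set \<Rightarrow> ('a \<Rightarrow> complex) \<Rightarrow> bool"
  where "multiplier H \<phi> \<longleftrightarrow> (\<forall>h\<in>H. (\<lambda>z. \<phi> z * h z) \<in> H)"

definition ell2_sum ::
    "('a \<Rightarrow> complex) set \<Rightarrow> (('a \<Rightarrow> complex) \<Rightarrow> ('a \<Rightarrow> complex) \<Rightarrow> complex)
     \<Rightarrow> (nat \<Rightarrow> 'a \<Rightarrow> complex) set"
  where "ell2_sum H ip = {h. (\<forall>j. h j \<in> H) \<and> summable (\<lambda>j. (hnorm ip (h j))\<^sup>2)}"

definition ell2_norm ::
    "(('a \<Rightarrow> complex) \<Rightarrow> ('a \<Rightarrow> complex) \<Rightarrow> complex) \<Rightarrow> (nat \<Rightarrow> 'a \<Rightarrow> complex) \<Rightarrow> real"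
  where "ell2_norm ip h = sqrt (\<Sum>j. (hnorm ip (h j))\<^sup>2)"

text \<open>\<open>g\<close> is the value of the row operator at \<open>h\<close>: the series converges to \<open>g\<close> in the norm of \<open>H\<close>.\<close>

definition row_value ::
    "(('a \<Rightarrow> complex) \<Rightarrow> ('a \<Rightarrow> complex) \<Rightarrow> complex) \<Rightarrow> (nat \<Rightarrow> 'a \<Rightarrow> complex)
     \<Rightarrow> (nat \<Rightarrow> 'a \<Rightarrow> complex) \<Rightarrow> ('a \<Rightarrow> complex) \<Rightarrow> bool"
  where "row_value ip \<phi> h g \<longleftrightarrow>
    (\<lambda>n. hnorm ip (\<lambda>z. (\<Sum>j<n. \<phi> j z * h j z) - g z)) \<longlonglongrightarrow> 0"

definition row_bounded ::
    "('a \<Rightarrow> complex) set \<Rightarrow> (('a \<Rightarrow> complex) \<Rightarrow> ('a \<Rightarrow> complex) \<Rightarrow> complex)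
     \<Rightarrow> (nat \<Rightarrow> 'a \<Rightarrow> complex) \<Rightarrow> bool"
  where "row_bounded H ip \<phi> \<longleftrightarrow>
    (\<exists>C. \<forall>h\<in>ell2_sum H ip. \<exists>g\<in>H. row_value ip \<phi> h g \<and> hnorm ip g \<le> C * ell2_norm ip h)"

definition column_op ::
    "(nat \<Rightarrow> 'a \<Rightarrow> complex) \<Rightarrow> ('a \<Rightarrow> complex) \<Rightarrow> (nat \<Rightarrow> 'a \<Rightarrow> complex)"
  where "column_op \<phi> h = (\<lambda>j z. \<phi> j z * h z)"

definition column_bounded ::
    "('a \<Rightarrow> complex) set \<Rightarrow> (('a \<Rightarrow> complex) \<Rightarrow> ('a \<Rightarrow> complex) \<Rightarrow> complex)
     \<Rightarrow> (nat \<Rightarrow> 'a \<Rightarrow> complex) \<Rightarrow> bool"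
  where "column_bounded H ip \<phi> \<longleftrightarrow>
    (\<exists>C. \<forall>h\<in>H. column_op \<phi> h \<in> ell2_sum H ip \<and>
                ell2_norm ip (column_op \<phi> h) \<le> C * hnorm ip h)"

end

(* The row (z_a, z_b) of two coordinate functions is a contraction, hence so is its n-th power, the
   row of all sqrt(binomial(n, k)) z_a^k z_b^(n-k). Its entries are unit vectors, so its column
   applied to 1 has squared norm n + 1. Scaling the n-th block by 1 / sqrt((n + 1)(n + 2)) makes the
   squared row norms summable, while the squared column norms at 1 add up to the harmonic series. *)

theory Submission
  imports Defs
begin

section \<open>Hilbert function spaces\<close>

text \<open>Only the kernel of \<open>H\<close> is given: that monomials or products lie in
  \<open>H\<close>, and what norms they have, must be derived from it. Multiplication operators are
  reached through their adjoints. The adjoint of multiplication by \<phi> sends \<open>k w\<close>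
  to \<open>cnj (\<phi> w)\<close> times \<open>k w\<close>, so on finite kernel combinations an
  operator inequality becomes an inequality between explicit Gram sums; a Riesz argument then turns
  it into membership in \<open>H\<close> with a norm bound. Monomial norms come from comparing
  coefficients after pairing with the expanded kernel: z_a^k z_b^l has squared norm 1 / binomial(k +
  l, k), which is what the factor sqrt(binomial(n, k)) normalises.

  Two distinct coordinates are where d \<ge> 2 enters: the n-th power of a single coordinate has one
  entry instead of n + 1, so its column at 1 does not grow. The block weights c_n have to be
  summable while the sum of (n + 1) c_n diverges; the choice 1 / ((n + 1)(n + 2)) telescopes to
  total mass at most 1, which makes the whole row a contraction.\<close>

context hilbert_function_space
begin

section \<open>Inner product geometry and Riesz representation\<close>

lemma diff_mem: "(\<lambda>z. f z - g z) \<in> H" if "f \<in> H" "g \<in> H"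
  using add_mem[OF that(1) scale_mem[OF that(2), of "-1"]] by simp

lemma ip_add_right: "ip h (\<lambda>z. f z + g z) = ip h f + ip h g" if "f \<in> H" "g \<in> H" "h \<in> H"
  using that ip_commute[OF _ that(3)] by (simp add: ip_add add_mem)

lemma ip_scale_right: "ip h (\<lambda>z. c * f z) = cnj c * ip h f" if "f \<in> H" "h \<in> H"
  using that ip_commute[OF _ that(2)] by (simp add: ip_scale scale_mem)

lemma ip_diff: "ip (\<lambda>z. f z - g z) h = ip f h - ip g h" if "f \<in> H" "g \<in> H" "h \<in> H"
  using that ip_add[OF that(1) scale_mem[OF that(2), of "-1"] that(3)] ip_scale[of g h "-1"] by simp

lemma ip_zero: "ip (\<lambda>z. 0) h = 0" if "h \<in> H"
  using ip_scale[OF that that, of 0] by simp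

lemma sum_mem: "(\<lambda>z. \<Sum>s\<in>S. a s * f s z) \<in> H" if "\<And>s. s \<in> S \<Longrightarrow> f s \<in> H"
  using that
  by (induction S rule: infinite_finite_induct) (simp_all add: zero_mem add_mem scale_mem)

lemma ip_sum: "ip (\<lambda>z. \<Sum>s\<in>S. a s * f s z) h = (\<Sum>s\<in>S. a s * ip (f s) h)"
  if "\<And>s. s \<in> S \<Longrightarrow> f s \<in> H" "h \<in> H"
  using that
  by (induction S rule: infinite_finite_induct)
     (simp_all add: ip_zero ip_add ip_scale sum_mem scale_mem)

lemma ip_sum_right: "ip h (\<lambda>z. \<Sum>s\<in>S. a s * f s z) = (\<Sum>s\<in>S. cnj (a s) * ip h (f s))"
  if "\<And>s. s \<in> S \<Longrightarrow> f s \<in> H" "h \<in> H"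
  using that ip_commute[OF _ that(2)] by (simp add: ip_sum sum_mem)

lemma hnorm_nonneg: "0 \<le> hnorm ip f" if "f \<in> H"
  by (simp add: hnorm_def ip_nonneg that)

lemma hnorm_power2: "(hnorm ip f)\<^sup>2 = Re (ip f f)" if "f \<in> H"
  by (simp add: hnorm_def ip_nonneg that)

lemma ip_self: "ip f f = of_real ((hnorm ip f)\<^sup>2)" if "f \<in> H"
  using ip_commute[OF that that] by (simp add: hnorm_power2 that complex_eq_iff)

lemma hnorm_scale: "hnorm ip (\<lambda>z. c * f z) = cmod c * hnorm ip f" if "f \<in> H"
proof -
  have "ip (\<lambda>z. c * f z) (\<lambda>z. c * f z) = of_real ((cmod c)\<^sup>2) * ip f f"
    using that
    by (simp add: ip_scale ip_scale_right scale_mem complex_norm_square del: of_real_power)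
  then show ?thesis
    by (simp add: hnorm_def real_sqrt_mult)
qed

lemma hnorm_diff_commute: "hnorm ip (\<lambda>z. f z - g z) = hnorm ip (\<lambda>z. g z - f z)"
  if "f \<in> H" "g \<in> H"
  using hnorm_scale[OF diff_mem[OF that], of "-1"] by simp

lemma hnorm_add_power2:
  "(hnorm ip (\<lambda>z. f z + g z))\<^sup>2 = (hnorm ip f)\<^sup>2 + 2 * Re (ip f g) + (hnorm ip g)\<^sup>2"
  if "f \<in> H" "g \<in> H"
  using that ip_commute[OF that] by (simp add: hnorm_power2 add_mem ip_add ip_add_right)

lemma Cauchy_Schwarz: "cmod (ip f g) \<le> hnorm ip f * hnorm ip g" if "f \<in> H" "g \<in> H"
proof (cases "hnorm ip g = 0")
  case True
  then have "g = (\<lambda>z. 0)"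
    using that by (intro ip_definite) (simp_all add: ip_self)
  then have "ip f g = 0"
    using ip_zero[OF that(1)] ip_commute[OF that(2,1)] that by simp
  with True show ?thesis by simp
next
  case False
  define N where "N = (hnorm ip g)\<^sup>2"
  have N: "N > 0" using False by (simp add: N_def)
  \<comment> \<open>This \<open>t\<close> minimises the norm of \<open>f + t * g\<close>: it removes
    from \<open>f\<close> its component along \<open>g\<close>.\<close>
  define t where "t = - ip f g / of_real N"
  have "0 \<le> (hnorm ip (\<lambda>z. f z + t * g z))\<^sup>2" by simp
  also have "\<dots> = (hnorm ip f)\<^sup>2 + 2 * Re (cnj t * ip f g) + (cmod t)\<^sup>2 * N"
    using that
    by (simp add: hnorm_add_power2 scale_mem ip_scale_right hnorm_scale N_def power_mult_distrib)
  also have "cnj t * ip f g = of_real (- (cmod (ip f g))\<^sup>2 / N)"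
    by (simp only: t_def complex_norm_square of_real_divide of_real_minus) (simp add: mult.commute)
  also have "(cmod t)\<^sup>2 * N = (cmod (ip f g))\<^sup>2 / N"
    using N by (simp add: t_def norm_divide power_divide power2_eq_square)
  finally have "(cmod (ip f g))\<^sup>2 / N \<le> (hnorm ip f)\<^sup>2" by simp
  then have "(cmod (ip f g))\<^sup>2 \<le> (hnorm ip f * hnorm ip g)\<^sup>2"
    using N by (simp add: N_def field_simps)
  then show ?thesis
    by (rule power2_le_imp_le) (simp add: hnorm_nonneg that)
qed

lemma hnorm_triangle: "hnorm ip (\<lambda>z. f z + g z) \<le> hnorm ip f + hnorm ip g" if "f \<in> H" "g \<in> H"
proof (rule power2_le_imp_le)
  have "Re (ip f g) \<le> hnorm ip f * hnorm ip g"
    using Cauchy_Schwarz[OF that] complex_Re_le_cmod[of "ip f g"] by linarith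
  then show "(hnorm ip (\<lambda>z. f z + g z))\<^sup>2 \<le> (hnorm ip f + hnorm ip g)\<^sup>2"
    using that by (simp add: hnorm_add_power2 power2_sum)
qed (simp add: hnorm_nonneg that)

text \<open>The midpoint form is what a minimising sequence needs: the midpoint of two
  near-minimisers stays in the subspace, so its functional value is bounded below.\<close>

lemma hnorm_parallelogram:
  "(hnorm ip (\<lambda>z. f z - g z))\<^sup>2
    = 2 * (hnorm ip f)\<^sup>2 + 2 * (hnorm ip g)\<^sup>2 - 4 * (hnorm ip (\<lambda>z. (1/2) * (f z + g z)))\<^sup>2"
  if "f \<in> H" "g \<in> H"
  using hnorm_add_power2[OF that(1) scale_mem[OF that(2), of "-1"]]
    hnorm_add_power2[OF that] hnorm_scale[OF that(2), of "-1"] ip_scale_right[OF that(2,1), of "-1"]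
    arg_cong[OF hnorm_scale[OF add_mem[OF that], of "1/2"], of "\<lambda>x. x\<^sup>2"]
  by (simp add: power_divide)

lemma tendsto_ip:
  assumes "\<And>n. u n \<in> H" "g \<in> H" "h \<in> H"
    and lim: "(\<lambda>n. hnorm ip (\<lambda>z. u n z - g z)) \<longlonglongrightarrow> 0"
  shows "(\<lambda>n. ip (u n) h) \<longlonglongrightarrow> ip g h"
proof (rule LIM_zero_cancel, rule Lim_null_comparison)
  show "\<forall>\<^sub>F n in sequentially.
      cmod (ip (u n) h - ip g h) \<le> hnorm ip (\<lambda>z. u n z - g z) * hnorm ip h"
    using assms Cauchy_Schwarz[OF diff_mem[OF assms(1,2)] assms(3)] by (simp add: ip_diff)
  show "(\<lambda>n. hnorm ip (\<lambda>z. u n z - g z) * hnorm ip h) \<longlonglongrightarrow> 0"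
    using tendsto_mult_right[OF lim, of "hnorm ip h"] by simp
qed

lemma tendsto_hnorm:
  assumes "\<And>n. u n \<in> H" "g \<in> H"
    and lim: "(\<lambda>n. hnorm ip (\<lambda>z. u n z - g z)) \<longlonglongrightarrow> 0"
  shows "(\<lambda>n. hnorm ip (u n)) \<longlonglongrightarrow> hnorm ip g"
proof (rule LIM_zero_cancel, rule Lim_null_comparison)
  show "\<forall>\<^sub>F n in sequentially.
      norm (hnorm ip (u n) - hnorm ip g) \<le> hnorm ip (\<lambda>z. u n z - g z)"
  proof (rule always_eventually, rule allI)
    fix n
    show "norm (hnorm ip (u n) - hnorm ip g) \<le> hnorm ip (\<lambda>z. u n z - g z)"
      using hnorm_triangle[OF diff_mem[OF assms(1)[of n] assms(2)] assms(2)]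
        hnorm_triangle[OF diff_mem[OF assms(2) assms(1)[of n]] assms(1)[of n]]
        hnorm_diff_commute[OF assms(2,1), of n] by simp
  qed
qed (rule lim)

text \<open>
  A pair \<open>(u, l) \<in> V\<close> records the value \<open>l\<close> at \<open>u\<close> of a conjugate-linear functional of norm at
  most \<open>C\<close> on the subspace \<open>fst ` V\<close>. The representing vector is the limit of a minimising
  sequence of \<open>\<parallel>u\<parallel>\<^sup>2 - 2 Re l\<close>, so no closure of the subspace is needed.
\<close>

lemma Riesz_subspace:
  fixes V :: "(('a \<Rightarrow> complex) \<times> complex) set"
  assumes V_H: "\<And>u l. (u, l) \<in> V \<Longrightarrow> u \<in> H"
    and V_zero: "((\<lambda>z. 0), 0) \<in> V"
    and V_add: "\<And>u l v m. (u, l) \<in> V \<Longrightarrow> (v, m) \<in> V \<Longrightarrow> ((\<lambda>z. u z + v z), l + m) \<in> V"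
    and V_scale: "\<And>c u l. (u, l) \<in> V \<Longrightarrow> ((\<lambda>z. c * u z), cnj c * l) \<in> V"
    and V_bound: "\<And>u l. (u, l) \<in> V \<Longrightarrow> cmod l \<le> C * hnorm ip u"
  obtains g where "g \<in> H" "\<And>u l. (u, l) \<in> V \<Longrightarrow> ip g u = l" "hnorm ip g \<le> C \<or> hnorm ip g = 0"
proof -
  define J where "J = (\<lambda>(u, l). (hnorm ip u)\<^sup>2 - 2 * Re l)"
  have J_lower: "- C\<^sup>2 \<le> J v" if "v \<in> V" for v
  proof -
    obtain u l where v: "v = (u, l)" by fastforce
    have "Re l \<le> C * hnorm ip u"
      using V_bound[of u l] that complex_Re_le_cmod[of l] v by simp
    \<comment> \<open>Completing the square: \<open>J\<close> is at least
      \<open>x\<^sup>2 - 2 * C * x\<close> with x the norm of \<open>u\<close>, and this is at least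
      \<open>- C\<^sup>2\<close>.\<close>
    moreover have "0 \<le> (hnorm ip u - C)\<^sup>2" by simp
    ultimately show ?thesis
      by (simp add: J_def v power2_diff mult.commute)
  qed
  define m where "m = Inf (J ` V)"
  have bdd: "bdd_below (J ` V)"
    using J_lower by (auto intro!: bdd_belowI2)
  have m_le: "m \<le> J v" if "v \<in> V" for v
    unfolding m_def using that bdd by (rule cINF_lower[rotated])
  define d where "d n = inverse (real (Suc n))" for n
  have "\<exists>v\<in>V. J v < m + d n" for n
    using cInf_lessD[of "J ` V" "m + d n"] V_zero by (auto simp: m_def d_def)
  then obtain v where v: "\<And>n. v n \<in> V" "\<And>n. J (v n) < m + d n"
    by metis
  define u where "u n = fst (v n)" for n
  define l where "l n = snd (v n)" for n
  have ul: "(u n, l n) \<in> V" for n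
    using v(1)[of n] by (simp add: u_def l_def)
  have J_ul: "J (v n) = (hnorm ip (u n))\<^sup>2 - 2 * Re (l n)" for n
    by (simp add: J_def u_def l_def split_beta)
  have u_H: "u n \<in> H" for n using V_H ul by blast
  have J_lim: "(\<lambda>n. J (v n)) \<longlonglongrightarrow> m"
  proof (rule tendsto_sandwich[of "\<lambda>_. m" _ _ "\<lambda>n. m + d n"])
    show "(\<lambda>n. m + d n) \<longlonglongrightarrow> m"
      unfolding d_def by (rule LIMSEQ_inverse_real_of_nat_add)
  qed (use v m_le in \<open>auto intro!: always_eventually less_imp_le\<close>)
  have dist: "(hnorm ip (\<lambda>z. u i z - u j z))\<^sup>2 \<le> 2 * d i + 2 * d j" for i j
  proof -
    \<comment> \<open>\<open>J\<close> at the midpoint is at least \<open>m\<close>, and the linear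
      part of \<open>J\<close> averages exactly, so the parallelogram law leaves only the excesses
      \<open>d i\<close> and \<open>d j\<close>.\<close>
    have "((\<lambda>z. (1/2) * (u i z + u j z)), cnj (1/2) * (l i + l j)) \<in> V"
      by (intro V_scale V_add ul)
    from m_le[OF this] v(2)[of i] v(2)[of j] show ?thesis
      unfolding hnorm_parallelogram[OF u_H u_H] J_ul by (simp add: J_def) argo
  qed
  have "\<exists>g\<in>H. (\<lambda>n. hnorm ip (\<lambda>z. u n z - g z)) \<longlonglongrightarrow> 0"
  proof (rule complete)
    fix e :: real assume e: "0 < e"
    obtain N where N: "4 / e\<^sup>2 < real N" using reals_Archimedean2 by blast
    show "\<exists>N. \<forall>i\<ge>N. \<forall>j\<ge>N. hnorm ip (\<lambda>z. u i z - u j z) < e"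
    proof (intro exI allI impI)
      fix i j assume ij: "N \<le> i" "N \<le> j"
      have N0: "0 < real N" using N e by (smt (verit) divide_pos_pos zero_less_power)
      have "(hnorm ip (\<lambda>z. u i z - u j z))\<^sup>2 \<le> 2 * d i + 2 * d j"
        by (rule dist)
      also have "\<dots> \<le> 2 * inverse (real N) + 2 * inverse (real N)"
        unfolding d_def using ij N0
        by (intro add_mono mult_left_mono le_imp_inverse_le) auto
      also have "\<dots> < e\<^sup>2"
        using N N0 e by (simp add: field_simps)
      finally show "hnorm ip (\<lambda>z. u i z - u j z) < e"
        using e by (simp add: power2_less_imp_less)
    qed
  qed (rule u_H)
  then obtain g where g: "g \<in> H" and lim: "(\<lambda>n. hnorm ip (\<lambda>z. u n z - g z)) \<longlonglongrightarrow> 0"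
    by blast
  have rep: "ip g x = k" if xk: "(x, k) \<in> V" for x k
  proof (rule ccontr)
    assume "ip g x \<noteq> k"
    define D where "D = ip g x - k"
    have D: "D \<noteq> 0" using \<open>ip g x \<noteq> k\<close> by (simp add: D_def)
    have x: "x \<in> H" using V_H xk by blast
    \<comment> \<open>Moving \<open>u n\<close> by \<open>- s * D\<close> along \<open>x\<close>
      lowers \<open>J\<close> to first order by 2 s |D|^2 in the limit, at second-order cost s^2
      |D|^2 times the squared norm of \<open>x\<close>. This \<open>s\<close> keeps the cost below
      the gain; the summand 1 also covers \<open>x = 0\<close>.\<close>
    define s where "s = 1 / (1 + (hnorm ip x)\<^sup>2)"
    define t where "t = - of_real s * D"
    have s: "0 < s" by (simp add: s_def add_pos_nonneg)
    have "m \<le> J (v n) + 2 * Re (cnj t * (ip (u n) x - k)) + (cmod t)\<^sup>2 * (hnorm ip x)\<^sup>2" for n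
    proof -
      have "((\<lambda>z. u n z + t * x z), l n + cnj t * k) \<in> V"
        by (intro V_scale V_add ul xk)
      from m_le[OF this] show ?thesis
        unfolding J_ul
        by (simp add: J_def hnorm_add_power2 u_H x scale_mem ip_scale_right hnorm_scale
            power_mult_distrib algebra_simps)
    qed
    moreover have "(\<lambda>n. J (v n) + 2 * Re (cnj t * (ip (u n) x - k)) + (cmod t)\<^sup>2 * (hnorm ip x)\<^sup>2)
        \<longlonglongrightarrow> m + 2 * Re (cnj t * (ip g x - k)) + (cmod t)\<^sup>2 * (hnorm ip x)\<^sup>2"
      by (intro tendsto_intros J_lim tendsto_ip u_H g x lim)
    ultimately have "m \<le> m + 2 * Re (cnj t * D) + (cmod t)\<^sup>2 * (hnorm ip x)\<^sup>2"
      unfolding D_def by (intro tendsto_lowerbound[where F = sequentially]) auto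
    moreover have "cnj t * D = of_real (- s * (cmod D)\<^sup>2)"
      by (simp add: t_def complex_norm_square mult.commute del: of_real_power)
    moreover have "(cmod t)\<^sup>2 = s\<^sup>2 * (cmod D)\<^sup>2"
      by (simp add: t_def norm_mult power_mult_distrib)
    ultimately have "2 * s * (cmod D)\<^sup>2 \<le> s\<^sup>2 * (cmod D)\<^sup>2 * (hnorm ip x)\<^sup>2" by simp
    then have "2 * (s * (cmod D)\<^sup>2) \<le> (s * (hnorm ip x)\<^sup>2) * (s * (cmod D)\<^sup>2)"
      by (simp add: power2_eq_square mult_ac)
    moreover have "0 < s * (cmod D)\<^sup>2" using s D by simp
    ultimately have "2 \<le> s * (hnorm ip x)\<^sup>2" by (simp only: mult_le_cancel_right_pos)
    moreover have "s * (hnorm ip x)\<^sup>2 \<le> 1"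
      using add_pos_nonneg[of 1 "(hnorm ip x)\<^sup>2"] by (simp add: s_def)
    ultimately show False by simp
  qed
  \<comment> \<open>\<open>V_bound\<close> speaks about elements of the subspace, whereas
    \<open>g\<close> is only a limit of such elements; the bound is carried over by continuity.
    Cancelling the norm of \<open>g\<close> then produces the disjunction, since \<open>C\<close>
    may be negative.\<close>
  have "(hnorm ip g)\<^sup>2 \<le> C * hnorm ip g"
  proof (rule tendsto_le[OF sequentially_bot])
    show "(\<lambda>n. C * hnorm ip (u n)) \<longlonglongrightarrow> C * hnorm ip g"
      by (intro tendsto_intros tendsto_hnorm u_H g lim)
    have "(\<lambda>n. cmod (ip (u n) g)) \<longlonglongrightarrow> cmod (ip g g)"
      by (intro tendsto_intros tendsto_ip u_H g lim)
    then show "(\<lambda>n. cmod (ip (u n) g)) \<longlonglongrightarrow> (hnorm ip g)\<^sup>2"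
      by (simp add: ip_self g norm_power)
    show "\<forall>\<^sub>F n in sequentially. cmod (ip (u n) g) \<le> C * hnorm ip (u n)"
      using V_bound[OF ul] rep[OF ul] ip_commute[OF g u_H] by simp
  qed
  then have "hnorm ip g \<le> C \<or> hnorm ip g = 0"
    using hnorm_nonneg[OF g] by (auto simp: power2_eq_square mult_le_cancel_right)
  with g rep that show ?thesis by blast
qed

section \<open>Membership and row bounds tested on kernel functions\<close>

lemma kernel_mem: "k w \<in> H" if "has_reproducing_kernel X H ip k" "w \<in> X"
  using that by (simp add: has_reproducing_kernel_def)

lemma kernel_reproduces: "ip f (k w) = f w"
  if "has_reproducing_kernel X H ip k" "w \<in> X" "f \<in> H"
  using that by (simp add: has_reproducing_kernel_def)

lemma kernel_combination_mem: "(\<lambda>z. \<Sum>w\<in>S. c w * k w z) \<in> H"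
  if "has_reproducing_kernel X H ip k" "S \<subseteq> X"
  using that by (intro sum_mem kernel_mem) auto

text \<open>The bound defines a conjugate-linear functional on the span of the kernels; its
  representing vector, tested against a single kernel, has the values of \<open>F\<close>. Kernels
  may be linearly dependent, so the functional is kept as a relation \<open>V\<close>, and the bound
  itself makes its value independent of the chosen combination.\<close>

lemma mem_if_bounded_on_kernels:
  assumes k: "has_reproducing_kernel X H ip k"
    and F0: "\<And>z. z \<notin> X \<Longrightarrow> F z = 0"
    and C: "0 \<le> C"
    and bound: "\<And>S c. finite S \<Longrightarrow> S \<subseteq> X \<Longrightarrow>
      cmod (\<Sum>w\<in>S. cnj (c w) * F w) \<le> C * hnorm ip (\<lambda>z. \<Sum>w\<in>S. c w * k w z)"
  shows "F \<in> H" "hnorm ip F \<le> C"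
proof -
  define V where "V = {(u, l). \<exists>S c. finite S \<and> S \<subseteq> X \<and>
    u = (\<lambda>z. \<Sum>w\<in>S. c w * k w z) \<and> l = (\<Sum>w\<in>S. cnj (c w) * F w)}"
  obtain g where g: "g \<in> H" and rep: "\<And>u l. (u, l) \<in> V \<Longrightarrow> ip g u = l"
    and le: "hnorm ip g \<le> C \<or> hnorm ip g = 0"
  proof (rule Riesz_subspace[of V C])
    show "u \<in> H" if "(u, l) \<in> V" for u l
      using that kernel_combination_mem[OF k] by (auto simp: V_def)
    show "((\<lambda>z. 0), 0) \<in> V"
      unfolding V_def by (auto intro!: exI[of _ "{}"])
    show "((\<lambda>z. c * u z), cnj c * l) \<in> V" if ul: "(u, l) \<in> V" for c u l
    proof -
      obtain S d where "finite S" "S \<subseteq> X"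
        "u = (\<lambda>z. \<Sum>w\<in>S. d w * k w z)" "l = (\<Sum>w\<in>S. cnj (d w) * F w)"
        using ul unfolding V_def by blast
      then show ?thesis
        unfolding V_def
        by (auto intro!: exI[of _ S] exI[of _ "\<lambda>w. c * d w"] simp: sum_distrib_left mult.assoc)
    qed
    show "((\<lambda>z. u z + v z), l + m) \<in> V" if ul: "(u, l) \<in> V" and vm: "(v, m) \<in> V" for u l v m
    proof -
      obtain S d where S: "finite S" "S \<subseteq> X"
        "u = (\<lambda>z. \<Sum>w\<in>S. d w * k w z)" "l = (\<Sum>w\<in>S. cnj (d w) * F w)"
        using ul unfolding V_def by blast
      obtain T e where T: "finite T" "T \<subseteq> X"
        "v = (\<lambda>z. \<Sum>w\<in>T. e w * k w z)" "m = (\<Sum>w\<in>T. cnj (e w) * F w)"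
        using vm unfolding V_def by blast
      \<comment> \<open>Extension by zero puts both combinations over the common index set
        \<open>S \<union> T\<close>, where coefficients can be added.\<close>
      define d' where "d' w = (if w \<in> S then d w else 0)" for w
      define e' where "e' w = (if w \<in> T then e w else 0)" for w
      have "u = (\<lambda>z. \<Sum>w\<in>S \<union> T. d' w * k w z)" "l = (\<Sum>w\<in>S \<union> T. cnj (d' w) * F w)"
        unfolding S using S(1) T(1)
        by (auto intro!: ext sum.mono_neutral_cong_left simp: d'_def)
      moreover have "v = (\<lambda>z. \<Sum>w\<in>S \<union> T. e' w * k w z)" "m = (\<Sum>w\<in>S \<union> T. cnj (e' w) * F w)"
        unfolding T using S(1) T(1)
        by (auto intro!: ext sum.mono_neutral_cong_left simp: e'_def)
      ultimately show ?thesis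
        unfolding V_def using S(1,2) T(1,2)
        by (auto intro!: exI[of _ "S \<union> T"] exI[of _ "\<lambda>w. d' w + e' w"]
            simp: sum.distrib distrib_right)
    qed
    show "cmod l \<le> C * hnorm ip u" if "(u, l) \<in> V" for u l
      using that bound by (auto simp: V_def)
  qed blast
  have "g = F"
  proof
    fix w
    show "g w = F w"
    proof (cases "w \<in> X")
      case True
      then have "(k w, F w) \<in> V"
        unfolding V_def by (auto intro!: exI[of _ "{w}"] exI[of _ "\<lambda>_. 1"])
      then show ?thesis
        using rep kernel_reproduces[OF k True g] by simp
    qed (simp add: F0 zero_outside g)
  qed
  with g le C show "F \<in> H" "hnorm ip F \<le> C" by auto
qed

text \<open>The hypothesis bounds the adjoint of the row on finite combinations of kernel functions.\<close>

lemma finite_row: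
  assumes k: "has_reproducing_kernel X H ip k"
    and h: "\<And>j. j \<in> A \<Longrightarrow> h j \<in> H"
    and C: "0 \<le> C"
    and adj: "\<And>S c. finite S \<Longrightarrow> S \<subseteq> X \<Longrightarrow>
      (\<Sum>j\<in>A. (hnorm ip (\<lambda>z. \<Sum>w\<in>S. (c w * cnj (\<phi> j w)) * k w z))\<^sup>2)
        \<le> C\<^sup>2 * (hnorm ip (\<lambda>z. \<Sum>w\<in>S. c w * k w z))\<^sup>2"
  shows "(\<lambda>z. \<Sum>j\<in>A. \<phi> j z * h j z) \<in> H"
    and "hnorm ip (\<lambda>z. \<Sum>j\<in>A. \<phi> j z * h j z) \<le> C * sqrt (\<Sum>j\<in>A. (hnorm ip (h j))\<^sup>2)"
proof -
  let ?F = "\<lambda>z. \<Sum>j\<in>A. \<phi> j z * h j z"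
  define M where "M = sqrt (\<Sum>j\<in>A. (hnorm ip (h j))\<^sup>2)"
  have M: "0 \<le> M" by (simp add: M_def sum_nonneg)
  have bound: "cmod (\<Sum>w\<in>S. cnj (c w) * ?F w) \<le> C * M * hnorm ip (\<lambda>z. \<Sum>w\<in>S. c w * k w z)"
    if S: "finite S" "S \<subseteq> X" for S c
  proof -
    define u where "u j = (\<lambda>z. \<Sum>w\<in>S. (c w * cnj (\<phi> j w)) * k w z)" for j
    have u: "u j \<in> H" for j
      unfolding u_def by (rule kernel_combination_mem[OF k S(2)])
    have "(\<Sum>w\<in>S. cnj (c w) * ?F w) = (\<Sum>j\<in>A. \<Sum>w\<in>S. cnj (c w) * (\<phi> j w * h j w))"
      unfolding sum_distrib_left by (rule sum.swap)
    also have "\<dots> = (\<Sum>j\<in>A. ip (h j) (u j))"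
    proof (rule sum.cong[OF refl])
      fix j assume j: "j \<in> A"
      show "(\<Sum>w\<in>S. cnj (c w) * (\<phi> j w * h j w)) = ip (h j) (u j)"
        unfolding u_def using h[OF j] S k
        by (subst ip_sum_right)
           (auto intro!: sum.cong kernel_mem simp: kernel_reproduces subset_iff mult.assoc)
    qed
    also have "cmod \<dots> \<le> (\<Sum>j\<in>A. \<bar>hnorm ip (h j)\<bar> * \<bar>hnorm ip (u j)\<bar>)"
      using Cauchy_Schwarz[OF h u]
      by (intro sum_norm_le) (simp add: hnorm_nonneg h u)
    also have "\<dots> \<le> L2_set (\<lambda>j. hnorm ip (h j)) A * L2_set (\<lambda>j. hnorm ip (u j)) A"
      by (rule L2_set_mult_ineq)
    \<comment> \<open>The second factor is the norm of the adjoint row applied to the kernel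
      combination, which \<open>adj\<close> controls.\<close>
    also have "\<dots> \<le> M * (C * hnorm ip (\<lambda>z. \<Sum>w\<in>S. c w * k w z))"
    proof (rule mult_mono)
      show "L2_set (\<lambda>j. hnorm ip (u j)) A \<le> C * hnorm ip (\<lambda>z. \<Sum>w\<in>S. c w * k w z)"
        unfolding L2_set_def u_def using adj[OF S, of c] C
        by (intro real_le_lsqrt)
           (auto simp: power_mult_distrib hnorm_nonneg kernel_combination_mem[OF k S(2)] sum_nonneg)
    qed (use M in \<open>auto simp: L2_set_def M_def sum_nonneg\<close>)
    finally show ?thesis by (simp add: mult_ac)
  qed
  have zero: "?F z = 0" if "z \<notin> X" for z
    using that h by (auto intro!: sum.neutral simp: zero_outside)
  show "?F \<in> H" "hnorm ip ?F \<le> C * sqrt (\<Sum>j\<in>A. (hnorm ip (h j))\<^sup>2)"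
    using mem_if_bounded_on_kernels[OF k zero _ bound] C M unfolding M_def by auto
qed

text \<open>A single multiplier is a row with one entry, indexed here by the unit type.\<close>

lemma multiplier_if_adjoint_bounded:
  assumes k: "has_reproducing_kernel X H ip k"
    and C: "0 \<le> C"
    and adj: "\<And>S c. finite S \<Longrightarrow> S \<subseteq> X \<Longrightarrow>
      hnorm ip (\<lambda>z. \<Sum>w\<in>S. (c w * cnj (\<phi> w)) * k w z)
        \<le> C * hnorm ip (\<lambda>z. \<Sum>w\<in>S. c w * k w z)"
    and h: "h \<in> H"
  shows "(\<lambda>z. \<phi> z * h z) \<in> H" "hnorm ip (\<lambda>z. \<phi> z * h z) \<le> C * hnorm ip h"
proof -
  have "(\<Sum>j\<in>{()}. (hnorm ip (\<lambda>z. \<Sum>w\<in>S. (c w * cnj (\<phi> w)) * k w z))\<^sup>2)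
      \<le> C\<^sup>2 * (hnorm ip (\<lambda>z. \<Sum>w\<in>S. c w * k w z))\<^sup>2"
    if S: "finite S" "S \<subseteq> X" for S c
    using power_mono[OF adj[OF S, of c] hnorm_nonneg[OF kernel_combination_mem[OF k S(2)]], of 2]
    by (simp add: power_mult_distrib)
  from finite_row[OF k _ C this, of "\<lambda>_. h"] h
  show "(\<lambda>z. \<phi> z * h z) \<in> H" "hnorm ip (\<lambda>z. \<phi> z * h z) \<le> C * hnorm ip h"
    by (simp_all add: hnorm_nonneg)
qed

text \<open>Because the constant is uniform in the finite index set \<open>A\<close>, the finite
  case bounds initial segments as well as blocks between \<open>n\<close> and \<open>m\<close>; the
  blocks make the partial sums Cauchy.\<close>

lemma row_boundedI:
  assumes k: "has_reproducing_kernel X H ip k"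
    and C: "0 \<le> C"
    and adj: "\<And>A S c. finite A \<Longrightarrow> finite S \<Longrightarrow> S \<subseteq> X \<Longrightarrow>
      (\<Sum>j\<in>A. (hnorm ip (\<lambda>z. \<Sum>w\<in>S. (c w * cnj (\<phi> j w)) * k w z))\<^sup>2)
        \<le> C\<^sup>2 * (hnorm ip (\<lambda>z. \<Sum>w\<in>S. c w * k w z))\<^sup>2"
  shows "row_bounded H ip \<phi>"
  unfolding row_bounded_def
proof (intro exI[of _ C] ballI)
  fix h assume "h \<in> ell2_sum H ip"
  then have h: "\<And>j. h j \<in> H" and sm: "summable (\<lambda>j. (hnorm ip (h j))\<^sup>2)"
    by (auto simp: ell2_sum_def)
  note row = finite_row[OF k _ C adj, of _ h]
  define F where "F n = (\<lambda>z. \<Sum>j<n. \<phi> j z * h j z)" for n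
  have F: "F n \<in> H" for n
    unfolding F_def by (rule row) (simp_all add: h)
  have F_le: "hnorm ip (F n) \<le> C * ell2_norm ip h" for n
  proof -
    have "hnorm ip (F n) \<le> C * sqrt (\<Sum>j<n. (hnorm ip (h j))\<^sup>2)"
      unfolding F_def by (rule row) (simp_all add: h)
    also have "\<dots> \<le> C * ell2_norm ip h"
      unfolding ell2_norm_def
      by (intro mult_left_mono C real_sqrt_le_mono sum_le_suminf sm) auto
    finally show ?thesis .
  qed
  have tail: "hnorm ip (\<lambda>z. F m z - F n z) \<le> C * sqrt (\<Sum>j=n..<m. (hnorm ip (h j))\<^sup>2)"
    if "n \<le> m" for m n
  proof -
    have "(\<lambda>z. F m z - F n z) = (\<lambda>z. \<Sum>j=n..<m. \<phi> j z * h j z)"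
      using that by (auto simp: F_def sum_diff_nat_ivl[of 0 n m, symmetric] lessThan_atLeast0)
    then show ?thesis
      using row(2)[of "{n..<m}"] h by simp
  qed
  have "\<exists>g\<in>H. (\<lambda>n. hnorm ip (\<lambda>z. F n z - g z)) \<longlonglongrightarrow> 0"
  proof (rule complete)
    fix e :: real assume e: "0 < e"
    \<comment> \<open>The divisor is \<open>C + 1\<close> because \<open>C\<close> may be 0;
      \<open>C * (e / (C + 1))\<close> is still below \<open>e\<close>.\<close>
    define r where "r = (e / (C + 1))\<^sup>2"
    have "0 < r" using e C by (simp add: r_def)
    then obtain N where N: "\<And>m n. N \<le> m \<Longrightarrow> norm (\<Sum>j=m..<n. (hnorm ip (h j))\<^sup>2) < r"
      using sm unfolding summable_Cauchy by meson
    have small: "hnorm ip (\<lambda>z. F m z - F n z) < e" if "N \<le> n" "n \<le> m" for m n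
    proof -
      have "sqrt (\<Sum>j=n..<m. (hnorm ip (h j))\<^sup>2) < sqrt r"
        using N[OF that(1), of m] by simp
      also have "sqrt r = e / (C + 1)"
        using e C by (simp add: r_def)
      finally have "sqrt (\<Sum>j=n..<m. (hnorm ip (h j))\<^sup>2) < e / (C + 1)" .
      then have "C * sqrt (\<Sum>j=n..<m. (hnorm ip (h j))\<^sup>2) \<le> C * (e / (C + 1))"
        using C by (intro mult_left_mono) auto
      also have "\<dots> < e"
        using e C by (simp add: field_simps)
      finally show ?thesis
        using tail[OF that(2)] by linarith
    qed
    show "\<exists>N. \<forall>m\<ge>N. \<forall>n\<ge>N. hnorm ip (\<lambda>z. F m z - F n z) < e"
    proof (intro exI allI impI)
      fix m n assume "N \<le> m" "N \<le> n"
      then show "hnorm ip (\<lambda>z. F m z - F n z) < e"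
        using small[of n m] small[of m n] hnorm_diff_commute[OF F F, of m n]
        by (cases "n \<le> m") auto
    qed
  qed (rule F)
  then obtain g where g: "g \<in> H" and lim: "(\<lambda>n. hnorm ip (\<lambda>z. F n z - g z)) \<longlonglongrightarrow> 0"
    by blast
  have "hnorm ip g \<le> C * ell2_norm ip h"
    using LIMSEQ_le_const2[OF tendsto_hnorm[OF F g lim]] F_le by blast
  with g lim show "\<exists>g\<in>H. row_value ip \<phi> h g \<and> hnorm ip g \<le> C * ell2_norm ip h"
    unfolding row_value_def F_def by blast
qed

end

section \<open>The Drury-Arveson space\<close>

lemma sum_Pascal:
  fixes f :: "nat \<Rightarrow> 'a :: comm_semiring_1"
  shows "(\<Sum>k\<le>Suc n. of_nat (Suc n choose k) * f k)
    = (\<Sum>k\<le>n. of_nat (n choose k) * f (Suc k)) + (\<Sum>k\<le>n. of_nat (n choose k) * f k)"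
proof -
  have "(\<Sum>k\<le>n. of_nat (n choose k) * f k) = (\<Sum>k\<le>Suc n. of_nat (n choose k) * f k)"
    by (simp add: binomial_eq_0)
  then show ?thesis
    by (simp add: sum.atMost_Suc_shift sum.distrib algebra_simps del: sum.atMost_Suc)
qed

text \<open>After subtracting the monomial, the series vanishes near 0, so all of its coefficients
  vanish by uniqueness of power series.\<close>

lemma powser_coeff_of_monomial:
  fixes a :: "nat \<Rightarrow> complex"
  assumes s: "0 < s"
    and sums: "\<And>x. norm x < s \<Longrightarrow> (\<lambda>m. a m * x ^ m) sums (c * x ^ n)"
  shows "a n = c"
proof -
  define b where "b m = a m - (if m = n then c else 0)" for m
  have sums_b: "(\<lambda>m. b m * x ^ m) sums 0" if "norm x < s" for x
  proof -
    have "(\<lambda>m. a m * x ^ m - (if m = n then c * x ^ m else 0)) sums (c * x ^ n - c * x ^ n)"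
      by (intro sums_diff sums that sums_single)
    also have "(\<lambda>m. a m * x ^ m - (if m = n then c * x ^ m else 0)) = (\<lambda>m. b m * x ^ m)"
      by (auto simp: b_def algebra_simps)
    finally show ?thesis by simp
  qed
  have "Abs_fps b = 0"
  proof (rule eval_fps_eqD)
    \<comment> \<open>Convergence at the one point \<open>s / 2\<close> already gives a positive
      radius.\<close>
    have "norm (of_real (s / 2) :: complex) \<le> conv_radius b"
      using sums_b[of "of_real (s / 2)"] s by (intro conv_radius_geI) (auto simp: sums_iff)
    then show "fps_conv_radius (Abs_fps b) > 0"
      unfolding fps_conv_radius_def using s
      by (auto simp: Abs_fps_inverse elim!: less_le_trans[rotated])
    have "eventually (\<lambda>x :: complex. x \<in> ball 0 s) (nhds 0)"
      using s by (intro eventually_nhds_in_open) auto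
    then show "\<forall>\<^sub>F x in nhds 0. eval_fps (Abs_fps b) x = eval_fps 0 x"
      by eventually_elim (use sums_b in \<open>auto simp: eval_fps_def sums_iff\<close>)
  qed simp
  then have "b n = 0" by (metis fps_nth_Abs_fps fps_zero_nth)
  then show ?thesis by (simp add: b_def)
qed

lemma norm_cinner_le: "norm (cinner z w) \<le> norm z * norm w"
proof -
  have "norm (cinner z w) \<le> (\<Sum>i\<in>UNIV. \<bar>norm (z $ i)\<bar> * \<bar>norm (w $ i)\<bar>)"
    unfolding cinner_def by (rule sum_norm_le) (simp add: norm_mult)
  also have "\<dots> \<le> norm z * norm w"
    unfolding norm_vec_def by (rule L2_set_mult_ineq)
  finally show ?thesis .
qed

lemma cinner_neq_1: "cinner z w \<noteq> 1" if "z \<in> ball 0 1" "w \<in> ball 0 1"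
proof
  assume "cinner z w = 1"
  with norm_cinner_le[of z w] have "1 \<le> norm z * norm w" by simp
  moreover have "norm z * norm w < 1 * 1"
    using that by (intro mult_strict_mono') auto
  ultimately show False by simp
qed

lemma cinner_mult_da_kernel: "cinner z w * da_kernel w z = da_kernel w z - 1"
  if "z \<in> ball 0 1" "w \<in> ball 0 1"
  using cinner_neq_1[OF that] that by (simp add: da_kernel_def field_simps)

lemma axis_add_axis_mem_ball: "axis a x + axis b y \<in> ball (0 :: complex ^ 'n) 1"
  if "cmod x + cmod y < 1"
proof -
  have *: "norm (axis i c :: complex ^ 'n) = cmod c" for i c
    by (simp add: norm_vec_def L2_set_def axis_def if_distrib[of "\<lambda>c. (norm c)\<^sup>2"] cong: if_cong)
  show ?thesis
    using norm_triangle_ineq[of "axis a x" "axis b y"] that unfolding mem_ball_0 * by linarith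
qed

lemma da_kernel_0: "da_kernel 0 z = (if z \<in> ball 0 1 then 1 else 0)"
  by (simp add: da_kernel_def cinner_def)

text \<open>The sum of the block weights, bounded by telescoping; it becomes the bound on the
  squared norm of the whole row.\<close>

lemma sum_inverse_consecutive_le_1: "(\<Sum>n<N. 1 / (real (n + 1) * real (n + 2))) \<le> 1"
proof -
  have "(\<Sum>n<N. 1 / (real (n + 1) * real (n + 2)))
      = (\<Sum>n<N. 1 / real (n + 1) - 1 / real (Suc n + 1))"
    by (intro sum.cong refl) (simp add: field_simps)
  also have "\<dots> = 1 - 1 / real (N + 1)"
    by (subst sum_lessThan_telescope') simp
  finally show ?thesis by simp
qed

section \<open>Coordinate rows and their powers on kernel combinations\<close>

locale drury_arveson_space =
  fixes H :: "(complex ^ 'n \<Rightarrow> complex) set"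
    and ip :: "(complex ^ 'n \<Rightarrow> complex) \<Rightarrow> (complex ^ 'n \<Rightarrow> complex) \<Rightarrow> complex"
  assumes drury_arveson: "drury_arveson H ip"
begin

sublocale hilbert_function_space "ball 0 1" H ip
  using drury_arveson by (simp add: drury_arveson_def)

lemma reproducing: "has_reproducing_kernel (ball 0 1) H ip da_kernel"
  using drury_arveson by (simp add: drury_arveson_def)

text \<open>Replacing the weights \<open>c w\<close> by \<open>c w * cnj (\<phi> w)\<close> gives
  the image of the combination under the adjoint of multiplication by \<phi>; all operator estimates
  below take this form.\<close>

definition comb :: "(complex ^ 'n) set \<Rightarrow> (complex ^ 'n \<Rightarrow> complex) \<Rightarrow> complex ^ 'n \<Rightarrow> complex"
  where "comb S c = (\<lambda>z. \<Sum>w\<in>S. c w * da_kernel w z)"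

lemma comb_mem: "comb S c \<in> H" if "S \<subseteq> ball 0 1"
  unfolding comb_def by (rule kernel_combination_mem[OF reproducing that])

lemma comb_scale: "comb S (\<lambda>w. t * c w) = (\<lambda>z. t * comb S c z)"
  by (simp add: comb_def sum_distrib_left mult.assoc)

lemma ip_comb:
  "ip (comb S c) (comb S c) = (\<Sum>w\<in>S. \<Sum>v\<in>S. c w * cnj (c v) * da_kernel w v)"
  if S: "S \<subseteq> ball 0 1"
proof -
  have "ip (comb S c) (comb S c) = (\<Sum>w\<in>S. c w * ip (da_kernel w) (comb S c))"
    using S unfolding comb_def[of S c]
    by (intro ip_sum kernel_mem[OF reproducing] kernel_combination_mem[OF reproducing]) auto
  also have "\<dots> = (\<Sum>w\<in>S. c w * (\<Sum>v\<in>S. cnj (c v) * da_kernel w v))"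
  proof (rule sum.cong[OF refl])
    fix w assume w: "w \<in> S"
    have "ip (da_kernel w) (comb S c) = (\<Sum>v\<in>S. cnj (c v) * ip (da_kernel w) (da_kernel v))"
      using S w unfolding comb_def
      by (intro ip_sum_right kernel_mem[OF reproducing]) auto
    also have "\<dots> = (\<Sum>v\<in>S. cnj (c v) * da_kernel w v)"
      using S w
      by (intro sum.cong refl arg_cong2[where f = "(*)"] kernel_reproduces[OF reproducing]
          kernel_mem[OF reproducing]) auto
    finally show "c w * ip (da_kernel w) (comb S c) = c w * (\<Sum>v\<in>S. cnj (c v) * da_kernel w v)"
      by simp
  qed
  finally show ?thesis
    by (simp add: sum_distrib_left mult.assoc)
qed

text \<open>The defect of the row of coordinate functions has rank one, as \<open>1 = (1 - \<langle>v, w\<rangle>) k\<^sub>w(v)\<close>.\<close>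

lemma coordinate_row_adjoint:
  assumes S: "S \<subseteq> ball 0 1"
  shows "(\<Sum>i\<in>UNIV. (hnorm ip (comb S (\<lambda>w. c w * cnj (w $ i))))\<^sup>2)
    = (hnorm ip (comb S c))\<^sup>2 - (cmod (\<Sum>w\<in>S. c w))\<^sup>2"
proof -
  have "of_real (\<Sum>i\<in>UNIV. (hnorm ip (comb S (\<lambda>w. c w * cnj (w $ i))))\<^sup>2)
      = (\<Sum>i\<in>UNIV. \<Sum>w\<in>S. \<Sum>v\<in>S. c w * cnj (w $ i) * cnj (c v * cnj (v $ i)) * da_kernel w v)"
    by (simp only: of_real_sum ip_self[symmetric] comb_mem[OF S] ip_comb[OF S])
  also have "\<dots> = (\<Sum>w\<in>S. \<Sum>v\<in>S. \<Sum>i\<in>UNIV.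
      c w * cnj (w $ i) * cnj (c v * cnj (v $ i)) * da_kernel w v)"
    by (subst sum.swap, intro sum.cong refl, rule sum.swap)
  also have "\<dots> = (\<Sum>w\<in>S. \<Sum>v\<in>S. c w * cnj (c v) * (cinner v w * da_kernel w v))"
    by (intro sum.cong refl)
       (simp add: cinner_def sum_distrib_left sum_distrib_right mult_ac)
  also have "\<dots> = (\<Sum>w\<in>S. \<Sum>v\<in>S. c w * cnj (c v) * (da_kernel w v - 1))"
    using S
    by (intro sum.cong refl arg_cong2[where f = "(*)"] cinner_mult_da_kernel) auto
  also have "\<dots> = ip (comb S c) (comb S c) - (\<Sum>w\<in>S. c w) * cnj (\<Sum>w\<in>S. c w)"
    unfolding ip_comb[OF S]
    by (simp add: right_diff_distrib sum_subtractf sum_product)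
  also have "\<dots> = of_real ((hnorm ip (comb S c))\<^sup>2 - (cmod (\<Sum>w\<in>S. c w))\<^sup>2)"
    by (simp only: ip_self[OF comb_mem[OF S]] complex_norm_square[symmetric] of_real_diff)
  finally show ?thesis
    by (simp only: of_real_eq_iff)
qed

lemma coordinate_adjoint:
  assumes S: "S \<subseteq> ball 0 1"
  shows "(\<Sum>i\<in>I. (hnorm ip (comb S (\<lambda>w. c w * cnj (w $ i))))\<^sup>2) \<le> (hnorm ip (comb S c))\<^sup>2"
proof -
  have "(\<Sum>i\<in>I. (hnorm ip (comb S (\<lambda>w. c w * cnj (w $ i))))\<^sup>2)
      \<le> (\<Sum>i\<in>UNIV. (hnorm ip (comb S (\<lambda>w. c w * cnj (w $ i))))\<^sup>2)"
    by (intro sum_mono2) auto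
  then show ?thesis
    unfolding coordinate_row_adjoint[OF S] by (smt (verit) zero_le_power2)
qed

lemma coordinate_mult:
  assumes "f \<in> H"
  shows "(\<lambda>z. z $ i * f z) \<in> H" "hnorm ip (\<lambda>z. z $ i * f z) \<le> hnorm ip f"
proof -
  have *: "hnorm ip (\<lambda>z. \<Sum>w\<in>S. (c w * cnj (w $ i)) * da_kernel w z)
      \<le> 1 * hnorm ip (\<lambda>z. \<Sum>w\<in>S. c w * da_kernel w z)"
    if S: "finite S" "S \<subseteq> ball 0 1" for S c
    using coordinate_adjoint[OF S(2), of c "{i}"]
      hnorm_nonneg[OF comb_mem[OF S(2)], of c]
    by (auto simp: comb_def[symmetric] dest: power2_le_imp_le)
  show "(\<lambda>z. z $ i * f z) \<in> H" "hnorm ip (\<lambda>z. z $ i * f z) \<le> hnorm ip f"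
    using multiplier_if_adjoint_bounded[OF reproducing _ *, of f] assms by auto
qed

lemma coordinate_power_mult: "(\<lambda>z. (z $ i) ^ k * f z) \<in> H" if "f \<in> H"
  using that by (induction k) (auto dest: coordinate_mult simp: mult.assoc)

text \<open>Peeling one factor off each monomial replaces \<open>c\<close> by its image under the
  adjoint of the a-th or b-th coordinate; Pascal's rule splits the binomial weights accordingly, and
  contractivity of the pair closes the induction. This is why \<open>c\<close> must be arbitrary in
  the induction hypothesis.\<close>

lemma monomial_adjoint:
  assumes S: "S \<subseteq> ball 0 1" and ab: "a \<noteq> b"
  shows "(\<Sum>k\<le>n. real (n choose k) *
      (hnorm ip (comb S (\<lambda>w. c w * cnj ((w $ a) ^ k * (w $ b) ^ (n - k)))))\<^sup>2)
    \<le> (hnorm ip (comb S c))\<^sup>2"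
proof (induction n arbitrary: c)
  case (Suc n)
  define N where "N c k l = (hnorm ip (comb S (\<lambda>w. c w * cnj ((w $ a) ^ k * (w $ b) ^ l))))\<^sup>2"
    for c k l
  let ?ca = "\<lambda>w. c w * cnj (w $ a)" and ?cb = "\<lambda>w. c w * cnj (w $ b)"
  have a: "N c (Suc k) l = N ?ca k l" and b: "N c k (Suc l) = N ?cb k l" for k l
    by (simp_all only: N_def power_Suc complex_cnj_mult mult_ac)
  have "(\<Sum>k\<le>Suc n. real (Suc n choose k) * N c k (Suc n - k))
      = (\<Sum>k\<le>n. real (n choose k) * N c (Suc k) (Suc n - Suc k))
        + (\<Sum>k\<le>n. real (n choose k) * N c k (Suc n - k))"
    by (rule sum_Pascal)
  also have "\<dots> = (\<Sum>k\<le>n. real (n choose k) * N ?ca k (n - k))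
        + (\<Sum>k\<le>n. real (n choose k) * N ?cb k (n - k))"
    by (intro arg_cong2[where f = "(+)"] sum.cong refl) (simp_all add: a b Suc_diff_le)
  also have "\<dots> \<le> (hnorm ip (comb S ?ca))\<^sup>2 + (hnorm ip (comb S ?cb))\<^sup>2"
    using Suc.IH[of ?ca] Suc.IH[of ?cb] by (simp add: N_def)
  also have "\<dots> \<le> (hnorm ip (comb S c))\<^sup>2"
    using coordinate_adjoint[OF S, of c "{a, b}"] ab by simp
  finally show ?case by (simp only: N_def)
qed simp

section \<open>Monomials and their norms\<close>

text \<open>The factor \<open>da_kernel 0\<close> is the constant 1 of \<open>H\<close>, that is,
  the indicator function of the ball; it makes the monomial vanish outside.\<close>

definition mono :: "'n \<Rightarrow> 'n \<Rightarrow> nat \<Rightarrow> nat \<Rightarrow> complex ^ 'n \<Rightarrow> complex"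
  where "mono a b k l = (\<lambda>z. (z $ a) ^ k * (z $ b) ^ l * da_kernel 0 z)"

lemma one_mem: "da_kernel 0 \<in> H"
  by (rule kernel_mem[OF reproducing]) simp

lemma mono_mem: "mono a b k l \<in> H"
  unfolding mono_def mult.assoc by (intro coordinate_power_mult one_mem)

text \<open>Applied to the constant 1 it puts the homogeneous parts of a kernel into
  \<open>H\<close>; applied to the kernel it makes the geometric remainder small. The crude factor
  from the triangle inequality suffices on the region where |x| + |y| < 1.\<close>

lemma linear_form_power_mult:
  assumes f: "f \<in> H"
  shows "(\<lambda>z. (z $ a * s + z $ b * t) ^ m * f z) \<in> H \<and>
    hnorm ip (\<lambda>z. (z $ a * s + z $ b * t) ^ m * f z) \<le> (cmod s + cmod t) ^ m * hnorm ip f"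
proof (induction m)
  case (Suc m)
  let ?g = "\<lambda>z. (z $ a * s + z $ b * t) ^ m * f z"
  have g: "?g \<in> H" using Suc.IH by blast
  have eq: "(\<lambda>z. (z $ a * s + z $ b * t) ^ Suc m * f z)
      = (\<lambda>z. s * (z $ a * ?g z) + t * (z $ b * ?g z))"
    by (intro ext) (simp only: power_Suc distrib_right distrib_left mult_ac)
  have "hnorm ip (\<lambda>z. s * (z $ a * ?g z) + t * (z $ b * ?g z))
      \<le> hnorm ip (\<lambda>z. s * (z $ a * ?g z)) + hnorm ip (\<lambda>z. t * (z $ b * ?g z))"
    by (intro hnorm_triangle scale_mem coordinate_mult g)
  also have "\<dots> = cmod s * hnorm ip (\<lambda>z. z $ a * ?g z) + cmod t * hnorm ip (\<lambda>z. z $ b * ?g z)"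
    by (simp only: hnorm_scale coordinate_mult g)
  also have "\<dots> \<le> cmod s * hnorm ip ?g + cmod t * hnorm ip ?g"
    by (intro add_mono mult_left_mono coordinate_mult g) auto
  also have "\<dots> = (cmod s + cmod t) * hnorm ip ?g"
    by (simp add: distrib_right)
  also have "\<dots> \<le> (cmod s + cmod t) * ((cmod s + cmod t) ^ m * hnorm ip f)"
    using Suc.IH by (intro mult_left_mono) auto
  finally have "hnorm ip (\<lambda>z. s * (z $ a * ?g z) + t * (z $ b * ?g z))
      \<le> (cmod s + cmod t) ^ Suc m * hnorm ip f"
    by (simp add: mult.assoc)
  moreover have "(\<lambda>z. s * (z $ a * ?g z) + t * (z $ b * ?g z)) \<in> H"
    by (intro add_mem scale_mem coordinate_mult g)
  ultimately show ?case unfolding eq by blast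
qed (simp add: f)

text \<open>Obtained by applying \<open>\<langle>f, _\<rangle>\<close> to the geometric series of the kernel.\<close>

lemma homogeneous_expansion:
  assumes f: "f \<in> H" and ab: "a \<noteq> b" and xy: "cmod x + cmod y < 1"
  shows "(\<lambda>m. \<Sum>k\<le>m. of_nat (m choose k) * x ^ k * y ^ (m - k) * ip f (mono a b k (m - k)))
    sums f (axis a x + axis b y)"
proof -
  define w :: "complex ^ 'n" where "w = axis a x + axis b y"
  define q where "q z = z $ a * cnj x + z $ b * cnj y" for z :: "complex ^ 'n"
  have w: "w \<in> ball 0 1"
    unfolding w_def by (rule axis_add_axis_mem_ball[OF xy])
  have q: "cinner z w = q z" for z
  proof -
    have "cinner z w = (\<Sum>i\<in>{a, b}. z $ i * cnj (w $ i))"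
      unfolding cinner_def by (intro sum.mono_neutral_right) (auto simp: w_def axis_def)
    then show ?thesis using ab by (simp add: w_def q_def axis_def)
  qed
  define p where "p m = (\<lambda>z. q z ^ m * da_kernel 0 z)" for m
  have p_mem: "p m \<in> H" for m
    unfolding p_def q_def using linear_form_power_mult[OF one_mem] by blast
  have kw: "da_kernel w \<in> H" by (rule kernel_mem[OF reproducing w])
  define r where "r M = (\<lambda>z. q z ^ M * da_kernel w z)" for M
  have r_mem: "r M \<in> H"
    and r_le: "hnorm ip (r M) \<le> (cmod x + cmod y) ^ M * hnorm ip (da_kernel w)" for M
    unfolding r_def q_def using linear_form_power_mult[OF kw, of a "cnj x" b "cnj y" M] by auto
  \<comment> \<open>The finite geometric sum with its exact remainder, so convergence only has to be
    shown for the pairing with \<open>r M\<close>. The factors 1 give the sum the shape of a linear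
    combination.\<close>
  have split: "da_kernel w = (\<lambda>z. (\<Sum>m<M. 1 * p m z) + r M z)" for M
  proof
    fix z :: "complex ^ 'n"
    show "da_kernel w z = (\<Sum>m<M. 1 * p m z) + r M z"
    proof (cases "z \<in> ball 0 1")
      case True
      have "1 - q z \<noteq> 0" using cinner_neq_1[OF True w] by (simp add: q)
      moreover have "da_kernel w z = 1 / (1 - q z)"
        using True by (simp add: da_kernel_def q)
      moreover have "(\<Sum>m<M. 1 * p m z) = (\<Sum>m<M. q z ^ m)"
        using True by (simp add: p_def da_kernel_0)
      moreover have "(\<Sum>m<M. q z ^ m) = (1 - q z ^ M) / (1 - q z)"
        using \<open>1 - q z \<noteq> 0\<close> one_diff_power_eq[of "q z" M] by (simp add: nonzero_eq_divide_eq)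
      ultimately show ?thesis
        by (simp add: r_def diff_divide_distrib)
    qed (simp add: p_def r_def da_kernel_def)
  qed
  have partial: "f w - (\<Sum>m<M. ip f (p m)) = ip f (r M)" for M
  proof -
    have "f w = ip f (da_kernel w)"
      by (rule kernel_reproduces[OF reproducing w f, symmetric])
    also have "\<dots> = ip f (\<lambda>z. \<Sum>m<M. 1 * p m z) + ip f (r M)"
      by (subst split[of M], intro ip_add_right sum_mem p_mem r_mem f)
    also have "ip f (\<lambda>z. \<Sum>m<M. 1 * p m z) = (\<Sum>m<M. cnj 1 * ip f (p m))"
      by (intro ip_sum_right p_mem f)
    finally show ?thesis by simp
  qed
  have "(\<lambda>M. f w - (\<Sum>m<M. ip f (p m))) \<longlonglongrightarrow> 0"
  proof (rule Lim_null_comparison)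
    show "(\<lambda>M. hnorm ip f * ((cmod x + cmod y) ^ M * hnorm ip (da_kernel w))) \<longlonglongrightarrow> 0"
      using xy by (intro tendsto_mult_right_zero tendsto_mult_left_zero LIMSEQ_power_zero) simp
    have "cmod (ip f (r M)) \<le> hnorm ip f * ((cmod x + cmod y) ^ M * hnorm ip (da_kernel w))" for M
      using Cauchy_Schwarz[OF f r_mem] mult_left_mono[OF r_le hnorm_nonneg[OF f]]
      by (rule order_trans)
    then show "\<forall>\<^sub>F M in sequentially. cmod (f w - (\<Sum>m<M. ip f (p m)))
        \<le> hnorm ip f * ((cmod x + cmod y) ^ M * hnorm ip (da_kernel w))"
      unfolding partial by simp
  qed
  then have "(\<lambda>M. \<Sum>m<M. ip f (p m)) \<longlonglongrightarrow> f w"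
    using tendsto_diff[OF tendsto_const[of "f w"]] by fastforce
  then have "(\<lambda>m. ip f (p m)) sums f w"
    by (simp add: sums_def)
  moreover have "ip f (p m)
      = (\<Sum>k\<le>m. of_nat (m choose k) * x ^ k * y ^ (m - k) * ip f (mono a b k (m - k)))" for m
  proof -
    have "p m = (\<lambda>z. \<Sum>k\<le>m. (of_nat (m choose k) * cnj x ^ k * cnj y ^ (m - k)) *
        mono a b k (m - k) z)"
      unfolding p_def q_def binomial_ring sum_distrib_right
      by (intro ext sum.cong refl) (simp add: mono_def power_mult_distrib mult_ac)
    then have "ip f (p m) = (\<Sum>k\<le>m. cnj (of_nat (m choose k) * cnj x ^ k * cnj y ^ (m - k)) *
        ip f (mono a b k (m - k)))"
      by (simp only:) (intro ip_sum_right mono_mem f)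
    then show ?thesis by simp
  qed
  ultimately show ?thesis by (simp add: w_def)
qed

text \<open>Let f be the monomial itself and evaluate its expansion at the point with coordinates x
  t and x. The value is t^i x^(i+j); comparing coefficients of x^(i+j), then of t^i, leaves
  binomial(i + j, i) times the inner product of f with itself, equal to 1.\<close>

lemma hnorm_mono:
  assumes ab: "a \<noteq> b"
  shows "real ((i + j) choose i) * (hnorm ip (mono a b i j))\<^sup>2 = 1"
proof -
  define f where "f = mono a b i j"
  define n where "n = i + j"
  define A where "A m t = (\<Sum>k\<le>m. of_nat (m choose k) * ip f (mono a b k (m - k)) * t ^ k)"
    for m and t :: complex
  have A: "A n t = t ^ i" for t
  proof (rule powser_coeff_of_monomial)
    show "0 < 1 / (cmod t + 1)" by (simp add: add_nonneg_pos)
    \<comment> \<open>The radius depends on \<open>t\<close>: it is exactly what keeps |x t| + |x|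
      below 1.\<close>
    fix x :: complex assume x: "cmod x < 1 / (cmod t + 1)"
    have "cmod (x * t) + cmod x < 1"
      using x add_nonneg_pos[of "cmod t" 1]
      by (simp add: norm_mult pos_less_divide_eq distrib_left)
    from homogeneous_expansion[OF mono_mem[of a b i j] ab this, folded f_def]
    have "(\<lambda>m. A m t * x ^ m) sums f (axis a (x * t) + axis b x)"
    proof (rule sums_cong[THEN iffD1, rotated])
      fix m
      show "(\<Sum>k\<le>m. of_nat (m choose k) * (x * t) ^ k * x ^ (m - k) *
          ip f (mono a b k (m - k))) = A m t * x ^ m"
        unfolding A_def sum_distrib_right
      proof (intro sum.cong refl)
        fix k assume "k \<in> {..m}"
        then have "x ^ m = x ^ k * x ^ (m - k)" by (simp flip: power_add)
        then show "of_nat (m choose k) * (x * t) ^ k * x ^ (m - k) * ip f (mono a b k (m - k))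
            = of_nat (m choose k) * ip f (mono a b k (m - k)) * t ^ k * x ^ m"
          by (simp only: power_mult_distrib mult_ac)
      qed
    qed
    also have "f (axis a (x * t) + axis b x) = t ^ i * x ^ n"
    proof -
      have "axis a (x * t) + axis b x \<in> ball 0 1"
        by (rule axis_add_axis_mem_ball) fact
      then show ?thesis
        using ab by (simp add: f_def mono_def n_def da_kernel_0 axis_def power_mult_distrib
            power_add mult_ac)
    qed
    finally show "(\<lambda>m. A m t * x ^ m) sums (t ^ i * x ^ n)" .
  qed
  have "\<forall>t. (\<Sum>k\<le>n. of_nat (n choose k) * ip f (mono a b k (n - k)) * t ^ k)
      = (\<Sum>k\<le>n. (if k = i then 1 else 0) * t ^ k)"
    using A by (simp add: A_def n_def if_distrib[of "\<lambda>c. c * _"] cong: if_cong)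
  then have "of_nat (n choose i) * ip f (mono a b i (n - i)) = 1"
    unfolding polyfun_eq_coeffs by (auto simp: n_def dest!: spec[of _ i])
  then have "complex_of_real (real (n choose i) * (hnorm ip f)\<^sup>2) = 1"
    using ip_self[OF mono_mem, of a b i j] by (simp add: n_def f_def)
  then show ?thesis
    unfolding n_def f_def by (simp only: of_real_eq_1_iff)
qed

section \<open>The weighted sequence of monomials\<close>

definition row_entry :: "'n \<Rightarrow> 'n \<Rightarrow> nat \<Rightarrow> nat \<Rightarrow> complex ^ 'n \<Rightarrow> complex"
  where "row_entry a b k l = (\<lambda>z.
    of_real (sqrt (real ((k + l) choose k) / (real (k + l + 1) * real (k + l + 2))))
      * ((z $ a) ^ k * (z $ b) ^ l))"

text \<open>Grouping by total degree n, each block is 1 / ((n + 1)(n + 2)) times a sum bounded by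
  \<open>monomial_adjoint\<close>, so the block weights add up to at most 1.\<close>

lemma row_entry_adjoint:
  assumes S: "S \<subseteq> ball 0 1" and ab: "a \<noteq> b" and P: "finite P"
  shows "(\<Sum>(k, l)\<in>P. (hnorm ip (comb S (\<lambda>w. c w * cnj (row_entry a b k l w))))\<^sup>2)
    \<le> (hnorm ip (comb S c))\<^sup>2"
proof -
  define Y where "Y k l = (hnorm ip (comb S (\<lambda>w. c w * cnj ((w $ a) ^ k * (w $ b) ^ l))))\<^sup>2"
    for k l
  define G where "G k l = real ((k + l) choose k) / (real (k + l + 1) * real (k + l + 2)) * Y k l"
    for k l
  have G: "(hnorm ip (comb S (\<lambda>w. c w * cnj (row_entry a b k l w))))\<^sup>2 = G k l" for k l
  proof -
    define t where "t = sqrt (real ((k + l) choose k) / (real (k + l + 1) * real (k + l + 2)))"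
    have "(\<lambda>w. c w * cnj (row_entry a b k l w))
        = (\<lambda>w. of_real t * (c w * cnj ((w $ a) ^ k * (w $ b) ^ l)))"
      by (simp add: row_entry_def t_def mult_ac)
    then have "hnorm ip (comb S (\<lambda>w. c w * cnj (row_entry a b k l w)))
        = \<bar>t\<bar> * hnorm ip (comb S (\<lambda>w. c w * cnj ((w $ a) ^ k * (w $ b) ^ l)))"
      by (simp only: comb_scale hnorm_scale comb_mem[OF S] norm_of_real)
    moreover have "t\<^sup>2 = real ((k + l) choose k) / (real (k + l + 1) * real (k + l + 2))"
      unfolding t_def by (rule real_sqrt_pow2) simp
    ultimately show ?thesis
      by (simp only: G_def Y_def power_mult_distrib power2_abs)
  qed
  obtain N where N: "\<And>p. p \<in> P \<Longrightarrow> fst p + snd p < N"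
    using P finite_nat_set_iff_bounded[of "(\<lambda>p. fst p + snd p) ` P"] by auto
  have fin: "finite {(k, l). k + l < N}"
    by (rule finite_subset[of _ "{..<N} \<times> {..<N}"]) auto
  \<comment> \<open>All terms are nonnegative, so \<open>P\<close> may be enlarged to a full
    triangle, which splits into complete degree blocks.\<close>
  have "(\<Sum>(k, l)\<in>P. G k l) \<le> (\<Sum>(k, l)\<in>{(k, l). k + l < N}. G k l)"
    using N by (intro sum_mono2 fin) (fastforce simp: G_def Y_def)+
  also have "\<dots> = (\<Sum>n<N. \<Sum>k\<le>n. G k (n - k))"
    by (rule sum.triangle_reindex)
  also have "\<dots> = (\<Sum>n<N. 1 / (real (n + 1) * real (n + 2)) *
      (\<Sum>k\<le>n. real (n choose k) * Y k (n - k)))"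
    unfolding sum_distrib_left by (intro sum.cong refl) (simp add: G_def)
  also have "\<dots> \<le> (\<Sum>n<N. 1 / (real (n + 1) * real (n + 2)) * (hnorm ip (comb S c))\<^sup>2)"
    unfolding Y_def by (intro sum_mono mult_left_mono monomial_adjoint S ab) simp
  also have "\<dots> \<le> 1 * (hnorm ip (comb S c))\<^sup>2"
    unfolding sum_distrib_right[symmetric] by (intro mult_right_mono sum_inverse_consecutive_le_1) simp
  finally show ?thesis by (simp add: G)
qed

lemma hnorm_row_entry:
  assumes ab: "a \<noteq> b"
  shows "(hnorm ip (\<lambda>z. row_entry a b k l z * da_kernel 0 z))\<^sup>2
    = 1 / (real (k + l + 1) * real (k + l + 2))"
proof -
  define t where "t = sqrt (real ((k + l) choose k) / (real (k + l + 1) * real (k + l + 2)))"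
  have "(\<lambda>z. row_entry a b k l z * da_kernel 0 z) = (\<lambda>z. of_real t * mono a b k l z)"
    by (simp add: row_entry_def mono_def t_def mult_ac)
  then have "(hnorm ip (\<lambda>z. row_entry a b k l z * da_kernel 0 z))\<^sup>2
      = t\<^sup>2 * (hnorm ip (mono a b k l))\<^sup>2"
    by (simp only: hnorm_scale mono_mem norm_of_real power_mult_distrib power2_abs)
  also have "t\<^sup>2 = real ((k + l) choose k) / (real (k + l + 1) * real (k + l + 2))"
    unfolding t_def by (rule real_sqrt_pow2) simp
  finally show ?thesis
    using hnorm_mono[OF ab, of k l] by simp
qed

lemma row_bounded_column_unbounded:
  assumes ab: "a \<noteq> b"
  defines "\<phi> \<equiv> \<lambda>j. case_prod (row_entry a b) (prod_decode j)"
  shows "\<forall>j. multiplier H (\<phi> j)" "row_bounded H ip \<phi>" "\<not> column_bounded H ip \<phi>"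
proof -
  have adj: "(\<Sum>j\<in>A. (hnorm ip (\<lambda>z. \<Sum>w\<in>S. (c w * cnj (\<phi> j w)) * da_kernel w z))\<^sup>2)
      \<le> 1\<^sup>2 * (hnorm ip (\<lambda>z. \<Sum>w\<in>S. c w * da_kernel w z))\<^sup>2"
    if "finite A" "finite S" "S \<subseteq> ball 0 1" for A S c
  proof -
    have "(\<Sum>j\<in>A. (hnorm ip (comb S (\<lambda>w. c w * cnj (\<phi> j w))))\<^sup>2)
        = (\<Sum>(k, l)\<in>prod_decode ` A. (hnorm ip (comb S (\<lambda>w. c w * cnj (row_entry a b k l w))))\<^sup>2)"
      by (subst sum.reindex) (auto simp: inj_prod_decode \<phi>_def split_beta)
    with row_entry_adjoint[OF that(3) ab, of "prod_decode ` A" c] that(1) show ?thesis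
      by (simp add: comb_def)
  qed
  show "row_bounded H ip \<phi>"
    by (rule row_boundedI[OF reproducing _ adj]) simp_all
  show "\<forall>j. multiplier H (\<phi> j)"
    unfolding multiplier_def
  proof (intro allI ballI)
    fix j h assume h: "h \<in> H"
    show "(\<lambda>z. \<phi> j z * h z) \<in> H"
      using finite_row(1)[OF reproducing _ _ adj, of "{j}" "\<lambda>_. h"] h by simp
  qed
  show "\<not> column_bounded H ip \<phi>"
  proof
    assume "column_bounded H ip \<phi>"
    \<comment> \<open>The constant 1 is the test vector: boundedness would make the squared norms of
      its column summable.\<close>
    then have sm: "summable (\<lambda>j. (hnorm ip (column_op \<phi> (da_kernel 0) j))\<^sup>2)"
      using one_mem by (auto simp: column_bounded_def ell2_sum_def)
    define T where "T = (\<Sum>j. (hnorm ip (column_op \<phi> (da_kernel 0) j))\<^sup>2)"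
    have entry: "(hnorm ip (column_op \<phi> (da_kernel 0) (prod_encode (k, l))))\<^sup>2
        = 1 / (real (k + l + 1) * real (k + l + 2))" for k l
      using hnorm_row_entry[OF ab, of k l] by (simp add: column_op_def \<phi>_def)
    \<comment> \<open>Degree n contributes n + 1 entries of squared norm 1 / ((n + 1)(n + 2)) each,
      hence 1 / (n + 2) in total.\<close>
    have "(\<Sum>n<N. 1 / real (n + 2)) \<le> T" for N
    proof -
      let ?P = "{(k, l). k + l < N}"
      have fin: "finite ?P"
        by (rule finite_subset[of _ "{..<N} \<times> {..<N}"]) auto
      have "(\<Sum>n<N. 1 / real (n + 2))
          = (\<Sum>n<N. \<Sum>k\<le>n. 1 / (real (k + (n - k) + 1) * real (k + (n - k) + 2)))"
      proof (rule sum.cong[OF refl])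
        fix n
        have "(\<Sum>k\<le>n. 1 / (real (k + (n - k) + 1) * real (k + (n - k) + 2)))
            = (\<Sum>k\<le>n. 1 / (real (n + 1) * real (n + 2)))"
          by (intro sum.cong refl) simp
        also have "\<dots> = 1 / real (n + 2)" by simp
        finally show "1 / real (n + 2)
            = (\<Sum>k\<le>n. 1 / (real (k + (n - k) + 1) * real (k + (n - k) + 2)))" ..
      qed
      also have "\<dots> = (\<Sum>(k, l)\<in>?P. 1 / (real (k + l + 1) * real (k + l + 2)))"
        by (rule sum.triangle_reindex[symmetric])
      also have "\<dots> = (\<Sum>j\<in>prod_encode ` ?P. (hnorm ip (column_op \<phi> (da_kernel 0) j))\<^sup>2)"
        by (subst sum.reindex) (auto simp: inj_prod_encode entry intro!: sum.cong)
      also have "\<dots> \<le> T"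
        unfolding T_def using fin by (intro sum_le_suminf sm) auto
      finally show ?thesis .
    qed
    then have "summable (\<lambda>n. 1 / real (n + 2))"
      by (intro summableI_nonneg_bounded) auto
    then have "summable (\<lambda>n. inverse (real n))"
      using summable_iff_shift[of "\<lambda>n. inverse (real n)" 2] by (simp add: inverse_eq_divide)
    then show False
      using not_summable_harmonic by blast
  qed
qed

end

theorem mainTheorem8:
  fixes H :: "(complex ^ 'n \<Rightarrow> complex) set"
    and ip :: "(complex ^ 'n \<Rightarrow> complex) \<Rightarrow> (complex ^ 'n \<Rightarrow> complex) \<Rightarrow> complex"
  assumes "CARD('n) \<ge> 2"
    and "drury_arveson H ip"
  shows "\<exists>\<phi> :: nat \<Rightarrow> complex ^ 'n \<Rightarrow> complex.
    (\<forall>j. multiplier H (\<phi> j)) \<and> row_bounded H ip \<phi> \<and> \<not> column_bounded H ip \<phi>"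
proof -
  interpret drury_arveson_space H ip
    by unfold_locales fact
  have "\<not> card (UNIV :: 'n set) \<le> Suc 0"
    using assms(1) by simp
  then obtain a b :: 'n where "a \<noteq> b"
    by (auto simp: card_le_Suc0_iff_eq)
  from row_bounded_column_unbounded[OF this] show ?thesis
    by (intro exI conjI)
qed

end
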